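(* Let $G$ be a connected graph of diameter $2$ and let $e$ be an edge of $G$. Then ${\rm gp}(G)-1\le {\rm gp}(G-e)\le {\rm gp}(G)+1$. Moreover, both bounds are sharp: there exist such $G$ and $e$ with ${\rm gp}(G-e)={\rm gp}(G)-1$, and there exist such $G$ and $e$ with ${\rm gp}(G-e)={\rm gp}(G)+1$.
   Context: All graphs are simple. A set $X\subseteq V(G)$ is a general position set of $G$ if for every pair of distinct $u,v\in X$ and every shortest $u,v$-path $P$ in $G$ we have $V(P)\cap X=\{u,v\}$ (vertices in different components impose no condition). ${\rm gp}(G)$ is the maximum cardinality of a general position set of $G$. $G-e$ is the graph obtained from $G$ by deleting the edge $e$. *)

theory Defs
  imports "Graph_Theory.Graph_Theory"
begin

text \<open>
  A finite simple graph is a \<^locale>\<open>pair_graph\<close>: a finite, loop-free, symmetric arc set, in which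
  the undirected edge \<open>uv\<close> is the pair of opposite arcs \<open>(u, v)\<close> and \<open>(v, u)\<close>.
\<close>

definition delete_edge :: "'a pair_pre_digraph \<Rightarrow> 'a \<times> 'a \<Rightarrow> 'a pair_pre_digraph" where
  "delete_edge G e = G\<lparr>parcs := parcs G - {e, (snd e, fst e)}\<rparr>"

definition graph_dist :: "('a, 'b) pre_digraph \<Rightarrow> 'a \<Rightarrow> 'a \<Rightarrow> ereal" where
  "graph_dist G u v = wf_digraph.\<mu> G (\<lambda>_. 1) u v"

definition diameter :: "('a, 'b) pre_digraph \<Rightarrow> ereal" where
  "diameter G = (SUP u\<in>verts G. SUP v\<in>verts G. graph_dist G u v)"

definition shortest_path :: "('a, 'b) pre_digraph \<Rightarrow> 'a \<Rightarrow> 'b awalk \<Rightarrow> 'a \<Rightarrow> bool" where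
  "shortest_path G u p v \<longleftrightarrow>
     pre_digraph.apath G u p v \<and> (\<forall>q. pre_digraph.apath G u q v \<longrightarrow> length p \<le> length q)"

definition general_position :: "('a, 'b) pre_digraph \<Rightarrow> 'a set \<Rightarrow> bool" where
  "general_position G X \<longleftrightarrow> X \<subseteq> verts G \<and>
     (\<forall>u\<in>X. \<forall>v\<in>X. u \<noteq> v \<longrightarrow>
        (\<forall>p. shortest_path G u p v \<longrightarrow> set (pre_digraph.awalk_verts G u p) \<inter> X = {u, v}))"

definition gp :: "('a, 'b) pre_digraph \<Rightarrow> nat" where
  "gp G = Max (card ` {X. general_position G X})"

end

theory Submission
  imports Defs
begin

text \<open>
  A general position set contains no induced path on three vertices, since such a path would be a
  shortest path; conversely, a set without induced three-vertex path is in general position as soon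
  as any two of its vertices in the same component are at distance at most two. If the edge \<open>ab\<close> is
  deleted from, or restored to, a graph of diameter two, every new induced three-vertex path contains
  both \<open>a\<close> and \<open>b\<close>, and a pair whose distance grows beyond two has, say, \<open>b\<close> as one end and \<open>a\<close> as
  the former midpoint. Hence discarding an endpoint of the edge, one lying in the set if there is
  any, always leaves a general position set of the other graph.
  The lower bound is attained by \<open>K\<^sub>4\<close> minus an edge, from which one deletes the edge opposite to the
  missing one, the upper bound by an edge of the path on three vertices.
\<close>

text \<open>In a loop-free graph this says that \<open>X\<close> induces a disjoint union of
  cliques, that is, no induced path on three vertices.\<close>

definition cluster_set :: "'a pair_pre_digraph \<Rightarrow> 'a set \<Rightarrow> bool" where
  "cluster_set G X \<longleftrightarrow>
     (\<forall>u\<in>X. \<forall>w\<in>X. \<forall>v\<in>X. u \<noteq> v \<and> (u, w) \<in> parcs G \<and> (w, v) \<in> parcs G \<longrightarrow> (u, v) \<in> parcs G)"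

text \<open>For distinct vertices this is distance at most two, phrased by arcs so that the effect
  of deleting an edge can be read off directly.\<close>

definition near :: "'a pair_pre_digraph \<Rightarrow> 'a \<Rightarrow> 'a \<Rightarrow> bool" where
  "near G u v \<longleftrightarrow> (u, v) \<in> parcs G \<or> (\<exists>w. (u, w) \<in> parcs G \<and> (w, v) \<in> parcs G)"

section \<open>Walks with at most two arcs\<close>

context pair_graph begin

lemma arc_commute: "(u, v) \<in> parcs G \<longleftrightarrow> (v, u) \<in> parcs G"
  using pair_sym_arcs by (auto simp: symmetric_def sym_def)

lemma awalk_length_1: "awalk u p v \<Longrightarrow> length p = 1 \<Longrightarrow> (u, v) \<in> parcs G"
  by (cases p) (auto simp: awalk_simps)

lemma near_awalk:
  assumes "awalk u p v" "length p \<le> 2" "u \<noteq> v"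
  shows "near G u v"
proof (cases p)
  case Nil
  then show ?thesis using assms by (simp add: awalk_simps)
next
  case (Cons e q)
  then show ?thesis using assms
    by (cases q) (auto simp: awalk_simps near_def)
qed

lemma near_imp_apath:
  assumes "near G u v" "u \<noteq> v"
  obtains p where "apath u p v" "length p \<le> 2"
proof -
  consider "(u, v) \<in> parcs G" | w where "(u, w) \<in> parcs G" "(w, v) \<in> parcs G"
    using assms(1) by (auto simp: near_def)
  then show thesis
  proof cases
    case 1
    then have "apath u [(u, v)] v"
      using assms(2) by (auto simp: apath_simps wellformed')
    then show thesis by (rule that) simp
  next
    case 2
    then have "apath u [(u, w), (w, v)] v"
      using assms(2) by (auto simp: apath_simps wellformed' dest: no_loops')
    then show thesis by (rule that) simp
  qed
qed

section \<open>General position and induced three-vertex paths\<close>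

lemma general_position_imp_cluster_set:
  assumes "general_position G X"
  shows "cluster_set G X"
  unfolding cluster_set_def
proof (intro ballI impI, elim conjE)
  fix u w v assume X: "u \<in> X" "w \<in> X" "v \<in> X"
    and arcs: "u \<noteq> v" "(u, w) \<in> parcs G" "(w, v) \<in> parcs G"
  show "(u, v) \<in> parcs G"
  proof (rule ccontr)
    assume nadj: "(u, v) \<notin> parcs G"
    have ne: "u \<noteq> w" "w \<noteq> v" using arcs by (auto dest: no_loops')
    let ?p = "[(u, w), (w, v)]"
    have "apath u ?p v" using arcs ne by (auto simp: apath_simps wellformed')
    \<comment> \<open>A shorter competitor would be empty, against \<open>u \<noteq> v\<close>, or a
      single arc, against nonadjacency.\<close>
    moreover have "length ?p \<le> length q" if "apath u q v" for q
    proof -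
      have "q \<noteq> []" using that arcs by (auto simp: apath_simps)
      moreover have "length q \<noteq> 1"
        using that nadj awalk_length_1 by (auto simp: apath_def)
      ultimately show ?thesis by (cases q) (auto simp: Suc_le_eq)
    qed
    ultimately have "shortest_path G u ?p v" by (simp add: shortest_path_def)
    then have "set (pawalk_verts u ?p) \<inter> X = {u, v}"
      using assms X arcs(1) unfolding general_position_def awalk_verts_with_proj_eq by blast
    then show False using X ne by auto
  qed
qed

text \<open>A shortest path has at most two arcs here, and its inner vertex, if any, lies outside
  \<open>X\<close>, as otherwise its ends would be adjacent. Nearness is asked only of mutually
  reachable pairs, so the criterion also covers disconnected graphs.\<close>

lemma cluster_set_imp_general_position:
  assumes cluster: "cluster_set G X" and "X \<subseteq> pverts G"
    and near: "\<And>u v. u \<in> X \<Longrightarrow> v \<in> X \<Longrightarrow> u \<noteq> v \<Longrightarrow> u \<rightarrow>\<^sup>*\<^bsub>G\<^esub> v \<Longrightarrow> near G u v"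
  shows "general_position G X"
  unfolding general_position_def
proof (intro conjI ballI impI allI)
  show "X \<subseteq> verts G" using assms by simp
  fix u v p assume X: "u \<in> X" "v \<in> X" and "u \<noteq> v" and p: "shortest_path G u p v"
  have path: "apath u p v" and min: "\<And>q. apath u q v \<Longrightarrow> length p \<le> length q"
    using p by (auto simp: shortest_path_def)
  have "u \<rightarrow>\<^sup>*\<^bsub>G\<^esub> v" using path by (auto simp: reachable_awalk apath_def)
  then obtain q where "apath u q v" "length q \<le> 2"
    using near[OF X \<open>u \<noteq> v\<close>] near_imp_apath \<open>u \<noteq> v\<close> by blast
  then have "length p \<le> 2" using min by fastforce
  then consider "p = []" | e where "p = [e]" | e f where "p = [e, f]"
    \<comment> \<open>This case rule serves only to split a list into empty, singleton and
      longer.\<close>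
    by (cases p rule: remdups_adj.cases) auto
  then have "set (pawalk_verts u p) \<inter> X = {u, v}"
  proof cases
    case 1
    then show ?thesis using path \<open>u \<noteq> v\<close> by (simp add: apath_simps)
  next
    case 2
    then show ?thesis using path X by (auto simp: apath_simps)
  next
    case 3
    obtain w where w: "p = [(u, w), (w, v)]" "(u, w) \<in> parcs G" "(w, v) \<in> parcs G"
      using path 3 by (cases e; cases f) (auto simp: apath_simps)
    have "w \<notin> X"
    proof
      assume "w \<in> X"
      then have "(u, v) \<in> parcs G"
        using cluster X w \<open>u \<noteq> v\<close> unfolding cluster_set_def by blast
      then have "apath u [(u, v)] v"
        using \<open>u \<noteq> v\<close> by (auto simp: apath_simps wellformed')
      then show False using min w(1) by fastforce
    qed
    then show ?thesis using w X by auto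
  qed
  then show "set (pre_digraph.awalk_verts G u p) \<inter> X = {u, v}" by simp
qed

section \<open>The general position number as an attained maximum\<close>

lemma finite_general_position: "finite {X. general_position G X}"
  by (rule finite_subset[of _ "Pow (pverts G)"]) (auto simp: general_position_def pair_finite_verts)

lemma card_le_gp: "general_position G X \<Longrightarrow> card X \<le> gp G"
  unfolding gp_def using finite_general_position by (intro Max_ge) auto

lemma gp_witness:
  obtains X where "general_position G X" "card X = gp G"
proof -
  \<comment> \<open>The empty set keeps the maximum from ranging over an empty family.\<close>
  have "general_position G {}" by (simp add: general_position_def)
  then have "gp G \<in> card ` {X. general_position G X}"
    unfolding gp_def using finite_general_position by (intro Max_in) auto
  then show thesis using that by auto
qed

text \<open>The upper bound is asked of all cluster sets, a condition on arcs alone, so that in a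
  small explicit graph it can be checked by enumeration without mentioning paths.\<close>

lemma gp_eqI:
  assumes "general_position G X" "\<And>Y. Y \<subseteq> pverts G \<Longrightarrow> cluster_set G Y \<Longrightarrow> card Y \<le> card X"
  shows "gp G = card X"
proof (rule antisym)
  obtain Y where Y: "general_position G Y" "card Y = gp G" by (rule gp_witness)
  then have "Y \<subseteq> pverts G" by (simp add: general_position_def)
  then show "gp G \<le> card X"
    using assms(2)[of Y] Y general_position_imp_cluster_set by metis
qed (rule card_le_gp[OF assms(1)])

section \<open>Distances, diameter two and connectedness\<close>

lemma graph_dist_conv: "graph_dist G u v = (INF p\<in>{p. awalk u p v}. ereal (real (length p)))"
proof -
  have "awalk_cost (\<lambda>_. 1) p = real (length p)" for p :: "('a \<times> 'a) list"
    by (induct p) auto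
  then show ?thesis by (simp add: graph_dist_def \<mu>_def)
qed

lemma near_of_diameter_le_2:
  assumes "diameter G \<le> 2" "u \<in> pverts G" "v \<in> pverts G" "u \<noteq> v"
  shows "near G u v"
proof -
  have "graph_dist G u v \<le> diameter G"
    unfolding diameter_def using assms by (intro SUP_upper2[of u] SUP_upper2[of v]) auto
  then have "graph_dist G u v \<le> ereal 2" using assms(1) by simp
  \<comment> \<open>A strict bound on the infimum is what yields an actual walk; being shorter than
    three, it has at most two arcs.\<close>
  also have "ereal 2 < ereal 3" by simp
  finally obtain p where "awalk u p v" "real (length p) < 3"
    by (auto simp: graph_dist_conv INF_less_iff)
  then show ?thesis using near_awalk[of u p v] assms(4) by auto
qed

text \<open>The distinct nonadjacent vertices \<open>a\<close> and \<open>b\<close> supply the lower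
  bound: no walk between them has fewer than two arcs.\<close>

lemma diameter_eq_2I:
  assumes near: "\<And>u v. u \<in> pverts G \<Longrightarrow> v \<in> pverts G \<Longrightarrow> u \<noteq> v \<Longrightarrow> near G u v"
    and ab: "a \<in> pverts G" "b \<in> pverts G" "a \<noteq> b" "(a, b) \<notin> parcs G"
  shows "diameter G = 2"
proof (rule antisym)
  have "graph_dist G u v \<le> 2" if uv: "u \<in> pverts G" "v \<in> pverts G" for u v
  proof -
    obtain p where "awalk u p v" "length p \<le> 2"
    proof (cases "u = v")
      case True
      then show ?thesis using that[of "[]"] uv by (simp add: awalk_simps)
    next
      case False
      then show ?thesis using near_imp_apath[OF near[OF uv]] that by (auto simp: apath_def)
    qed
    then have "graph_dist G u v \<le> ereal (real (length p))"
      by (auto simp: graph_dist_conv intro: INF_lower)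
    also have "\<dots> \<le> ereal 2" using \<open>length p \<le> 2\<close> by simp
    finally show ?thesis by simp
  qed
  then show "diameter G \<le> 2" by (auto simp: diameter_def intro!: SUP_least)
  have "2 \<le> length p" if "awalk a p b" for p
  proof -
    have "p \<noteq> []" using that ab by (auto simp: awalk_simps)
    moreover have "length p \<noteq> 1" using that ab awalk_length_1 by auto
    ultimately show ?thesis by (cases p) (auto simp: Suc_le_eq)
  qed
  then have "ereal 2 \<le> graph_dist G a b"
    unfolding graph_dist_conv by (intro INF_greatest) auto
  also have "\<dots> \<le> diameter G"
    unfolding diameter_def using ab by (intro SUP_upper2[of a] SUP_upper2[of b]) auto
  finally show "2 \<le> diameter G" by simp
qed

lemma connectedI_near:
  assumes "\<And>u v. u \<in> pverts G \<Longrightarrow> v \<in> pverts G \<Longrightarrow> u \<noteq> v \<Longrightarrow> near G u v" "pverts G \<noteq> {}"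
  shows "connected G"
proof -
  have "u \<rightarrow>\<^sup>*\<^bsub>G\<^esub> v" if uv: "u \<in> pverts G" "v \<in> pverts G" for u v
  proof (cases "u = v")
    case True
    then show ?thesis using uv by simp
  next
    case False
    then show ?thesis
      using near_imp_apath[OF assms(1)[OF uv]] by (auto simp: reachable_awalk apath_def)
  qed
  then show ?thesis
    using assms(2) by (auto simp: connected_def strongly_connected_def intro: reachable_mk_symmetricI)
qed

section \<open>The two bounds for the deletion of an edge\<close>

lemma pair_graph_delete_edge: "pair_graph (delete_edge G e)"
  by unfold_locales
    (auto simp: delete_edge_def symmetric_def sym_def arc_commute pair_finite_verts
      pair_finite_arcs dest: wellformed' no_loops')

lemma parcs_delete_edge: "parcs (delete_edge G (a, b)) = parcs G - {(a, b), (b, a)}"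
  by (simp add: delete_edge_def)

lemma pverts_delete_edge: "pverts (delete_edge G e) = pverts G"
  by (simp add: delete_edge_def)

lemma gp_delete_edge_le:
  assumes diam: "diameter G \<le> 2"
  shows "gp (delete_edge G (a, b)) \<le> gp G + 1"
proof -
  let ?H = "delete_edge G (a, b)"
  interpret H: pair_graph ?H by (rule pair_graph_delete_edge)
  obtain X where X: "general_position ?H X" "card X = gp ?H" by (rule H.gp_witness)
  have sub: "X \<subseteq> pverts G" using X(1) by (simp add: general_position_def pverts_delete_edge)
  have "cluster_set ?H X" using X(1) by (rule H.general_position_imp_cluster_set)
  \<comment> \<open>Among vertices other than \<open>a\<close>, the graphs \<open>G\<close> and
    \<open>?H\<close> have the same arcs.\<close>
  then have "cluster_set G (X - {a})"
    unfolding cluster_set_def parcs_delete_edge by blast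
  then have "general_position G (X - {a})"
    using sub near_of_diameter_le_2[OF diam] by (intro cluster_set_imp_general_position) auto
  then have "card (X - {a}) \<le> gp G" by (rule card_le_gp)
  moreover have "card X \<le> card (X - {a}) + 1"
    by (auto simp: card_Diff_singleton_if)
  ultimately show ?thesis using X(2) by simp
qed

text \<open>As \<open>a\<close> is outside \<open>Y\<close>, a two-step route between vertices of
  \<open>Y\<close> is broken only if it has \<open>b\<close> as an end and \<open>a\<close> as its
  midpoint. The condition on \<open>b\<close> then puts the whole route into \<open>X\<close>, where
  it cannot be an induced path.\<close>

lemma general_position_delete_edge:
  assumes diam: "diameter G \<le> 2" and "general_position G X" "Y \<subseteq> X" "a \<notin> Y"
    and b: "b \<in> Y \<Longrightarrow> a \<in> X"
  shows "general_position (delete_edge G (a, b)) Y"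
proof -
  let ?H = "delete_edge G (a, b)"
  interpret H: pair_graph ?H by (rule pair_graph_delete_edge)
  have sub: "Y \<subseteq> pverts G" using assms by (auto simp: general_position_def)
  have cluster: "cluster_set G X"
    using assms(2) by (rule general_position_imp_cluster_set)
  \<comment> \<open>The closing arc provided by \<open>G\<close> survives in \<open>?H\<close>,
    since neither of its ends is \<open>a\<close>.\<close>
  have "cluster_set ?H Y"
    using cluster assms(3,4) unfolding cluster_set_def parcs_delete_edge by blast
  moreover have "near ?H u v" if uv: "u \<in> Y" "v \<in> Y" "u \<noteq> v" for u v
  proof (cases "(u, v) \<in> parcs G")
    case True
    then show ?thesis using uv assms(4) by (auto simp: near_def parcs_delete_edge)
  next
    case False
    then obtain w where w: "(u, w) \<in> parcs G" "(w, v) \<in> parcs G"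
      using near_of_diameter_le_2[OF diam, of u v] uv sub by (auto simp: near_def)
    \<comment> \<open>A two-step route through the deleted edge would be \<open>b, a, v\<close>, an induced path inside \<open>X\<close>.\<close>
    have "w \<noteq> a" if "u = b \<or> v = b"
      using that uv w False b cluster assms(3) unfolding cluster_set_def by blast
    then have "(u, w) \<in> parcs ?H" "(w, v) \<in> parcs ?H"
      using w uv assms(4) by (auto simp: parcs_delete_edge)
    then show ?thesis by (auto simp: near_def)
  qed
  ultimately show ?thesis
    using sub by (intro H.cluster_set_imp_general_position) (auto simp: pverts_delete_edge)
qed

lemma gp_le_gp_delete_edge:
  assumes diam: "diameter G \<le> 2"
  shows "gp G \<le> gp (delete_edge G (a, b)) + 1"
proof -
  let ?H = "delete_edge G (a, b)"
  interpret H: pair_graph ?H by (rule pair_graph_delete_edge)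
  have swap: "delete_edge G (b, a) = ?H" by (simp add: delete_edge_def insert_commute)
  obtain X where X: "general_position G X" "card X = gp G" by (rule gp_witness)
  \<comment> \<open>If \<open>a\<close> is not in \<open>X\<close>, the endpoints exchange roles and
    the condition on the remaining endpoint holds vacuously.\<close>
  obtain c where "general_position ?H (X - {c})"
  proof (cases "a \<in> X")
    case True
    then show ?thesis
      using that general_position_delete_edge[OF diam X(1), of "X - {a}" a b] by auto
  next
    case False
    then show ?thesis
      using that general_position_delete_edge[OF diam X(1), of "X - {b}" b a] by (auto simp: swap)
  qed
  then have "card (X - {c}) \<le> gp ?H" by (rule H.card_le_gp)
  moreover have "card X \<le> card (X - {c}) + 1"
    by (auto simp: card_Diff_singleton_if)
  ultimately show ?thesis using X(2) by simp
qed

end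

section \<open>Two graphs attaining the bounds\<close>

definition diamond :: "nat pair_pre_digraph" where
  "diamond = \<lparr>pverts = {0, 1, 2, 3},
     parcs = {(0,1), (1,0), (0,2), (2,0), (0,3), (3,0), (1,2), (2,1), (1,3), (3,1)}\<rparr>"

definition path3 :: "nat pair_pre_digraph" where
  "path3 = \<lparr>pverts = {0, 1, 2}, parcs = {(0,1), (1,0), (1,2), (2,1)}\<rparr>"

lemma pair_graph_diamond: "pair_graph diamond"
  by unfold_locales (auto simp: diamond_def symmetric_def sym_def)

lemma pair_graph_path3: "pair_graph path3"
  by unfold_locales (auto simp: path3_def symmetric_def sym_def)

lemma near_diamond: "u \<in> pverts diamond \<Longrightarrow> v \<in> pverts diamond \<Longrightarrow> u \<noteq> v \<Longrightarrow> near diamond u v"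
  by (auto simp: diamond_def near_def)

lemma near_path3: "u \<in> pverts path3 \<Longrightarrow> v \<in> pverts path3 \<Longrightarrow> u \<noteq> v \<Longrightarrow> near path3 u v"
  by (auto simp: path3_def near_def)

lemma gp_diamond: "gp diamond = 3"
proof -
  interpret pair_graph diamond by (rule pair_graph_diamond)
  \<comment> \<open>These vertices form a triangle; all four vertices fail, because 2, 0, 3 is an
    induced path.\<close>
  have "general_position diamond {0, 1, 2}"
    by (rule cluster_set_imp_general_position)
      (auto simp: cluster_set_def near_def diamond_def)
  moreover have "card Y \<le> card {0, 1, 2::nat}" if "Y \<subseteq> pverts diamond" "cluster_set diamond Y" for Y
  proof -
    \<comment> \<open>Unfolding the power set gives sixteen explicit sets to check.\<close>
    have "Y \<in> Pow {0, 1, 2, 3}" using that by (simp add: diamond_def)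
    then show ?thesis using that(2)
      unfolding Pow_insert Pow_empty by (auto simp: cluster_set_def diamond_def)
  qed
  ultimately have "gp diamond = card {0, 1, 2::nat}" by (rule gp_eqI)
  then show ?thesis by simp
qed

text \<open>What remains is the four-cycle 0, 2, 1, 3, in which any three vertices form an induced
  path.\<close>

lemma gp_diamond_delete: "gp (delete_edge diamond (0, 1)) = 2"
proof -
  interpret D: pair_graph diamond by (rule pair_graph_diamond)
  interpret pair_graph "delete_edge diamond (0, 1)" by (rule D.pair_graph_delete_edge)
  have "general_position (delete_edge diamond (0, 1)) {0, 2}"
    by (rule cluster_set_imp_general_position)
      (auto simp: cluster_set_def diamond_def near_def delete_edge_def)
  moreover have "card Y \<le> card {0, 2::nat}"
    if "Y \<subseteq> pverts (delete_edge diamond (0, 1))" "cluster_set (delete_edge diamond (0, 1)) Y" for Y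
  proof -
    have "Y \<in> Pow {0, 1, 2, 3}" using that by (simp add: diamond_def delete_edge_def)
    then show ?thesis using that(2)
      unfolding Pow_insert Pow_empty by (auto simp: cluster_set_def diamond_def delete_edge_def)
  qed
  ultimately have "gp (delete_edge diamond (0, 1)) = card {0, 2::nat}" by (rule gp_eqI)
  then show ?thesis by simp
qed

lemma gp_path3: "gp path3 = 2"
proof -
  interpret pair_graph path3 by (rule pair_graph_path3)
  have "general_position path3 {0, 1}"
    by (rule cluster_set_imp_general_position)
      (auto simp: cluster_set_def near_def path3_def)
  moreover have "card Y \<le> card {0, 1::nat}" if "Y \<subseteq> pverts path3" "cluster_set path3 Y" for Y
  proof -
    have "Y \<in> Pow {0, 1, 2}" using that by (simp add: path3_def)
    then show ?thesis using that(2)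
      unfolding Pow_insert Pow_empty by (auto simp: cluster_set_def path3_def)
  qed
  ultimately have "gp path3 = card {0, 1::nat}" by (rule gp_eqI)
  then show ?thesis by simp
qed

text \<open>The vertex 0 becomes isolated and 1, 2 stay adjacent, so the whole vertex set is in
  general position: the only reachable pair of distinct vertices is an edge.\<close>

lemma gp_path3_delete: "gp (delete_edge path3 (0, 1)) = 3"
proof -
  interpret P: pair_graph path3 by (rule pair_graph_path3)
  let ?H = "delete_edge path3 (0, 1)"
  interpret pair_graph ?H by (rule P.pair_graph_delete_edge)
  have isolated: "(0, x) \<notin> parcs ?H" "(x, 0) \<notin> parcs ?H" for x
    by (auto simp: delete_edge_def path3_def)
  have out: "v = 0" if "0 \<rightarrow>\<^sup>*\<^bsub>?H\<^esub> v" for v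
    using that isolated(1) by (cases rule: converse_reachable_cases) auto
  have into: "u = 0" if "u \<rightarrow>\<^sup>*\<^bsub>?H\<^esub> 0" for u
    using out symmetric_reachable[OF pair_sym_arcs that] by simp
  have "general_position ?H {0, 1, 2}"
  proof (rule cluster_set_imp_general_position)
    fix u v :: nat assume "u \<in> {0, 1, 2}" "v \<in> {0, 1, 2}" "u \<noteq> v" "u \<rightarrow>\<^sup>*\<^bsub>?H\<^esub> v"
    moreover from this have "u \<noteq> 0" "v \<noteq> 0" using out into by metis+
    ultimately have "{u, v} = {1, 2}" by auto
    then show "near ?H u v" by (auto simp: near_def delete_edge_def path3_def doubleton_eq_iff)
  qed (auto simp: cluster_set_def delete_edge_def path3_def)
  moreover have "card Y \<le> card {0, 1, 2::nat}" if "Y \<subseteq> pverts ?H" for Y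
    using that by (intro card_mono) (auto simp: delete_edge_def path3_def)
  ultimately have "gp ?H = card {0, 1, 2::nat}" by (rule gp_eqI)
  then show ?thesis by simp
qed

theorem theorem6p3:
  shows "(\<forall>(G :: 'a pair_pre_digraph) e.
            pair_graph G \<and> connected G \<and> diameter G = 2 \<and> e \<in> parcs G \<longrightarrow>
              int (gp G) - 1 \<le> int (gp (delete_edge G e)) \<and>
              int (gp (delete_edge G e)) \<le> int (gp G) + 1) \<and>
         (\<exists>(G :: nat pair_pre_digraph) e.
            pair_graph G \<and> connected G \<and> diameter G = 2 \<and> e \<in> parcs G \<and>
              int (gp (delete_edge G e)) = int (gp G) - 1) \<and>
         (\<exists>(G :: nat pair_pre_digraph) e.
            pair_graph G \<and> connected G \<and> diameter G = 2 \<and> e \<in> parcs G \<and>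
              int (gp (delete_edge G e)) = int (gp G) + 1)"
proof (intro conjI)
  show "\<forall>(G :: 'a pair_pre_digraph) e.
          pair_graph G \<and> connected G \<and> diameter G = 2 \<and> e \<in> parcs G \<longrightarrow>
            int (gp G) - 1 \<le> int (gp (delete_edge G e)) \<and>
            int (gp (delete_edge G e)) \<le> int (gp G) + 1"
  proof (intro allI impI, elim conjE)
    fix G :: "'a pair_pre_digraph" and e :: "'a \<times> 'a"
    assume G: "pair_graph G" "diameter G = 2"
    obtain a b where e: "e = (a, b)" by (cases e)
    have "diameter G \<le> 2" using G(2) by simp
    then show "int (gp G) - 1 \<le> int (gp (delete_edge G e)) \<and>
        int (gp (delete_edge G e)) \<le> int (gp G) + 1"
      using pair_graph.gp_delete_edge_le[OF G(1), of a b]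
        pair_graph.gp_le_gp_delete_edge[OF G(1), of a b] e by auto
  qed
next
  \<comment> \<open>The nonadjacent pair 2, 3 excludes a smaller diameter.\<close>
  have "diameter diamond = 2"
    by (rule pair_graph.diameter_eq_2I[OF pair_graph_diamond near_diamond, of 2 3])
      (auto simp: diamond_def)
  moreover have "connected diamond"
    by (rule pair_graph.connectedI_near[OF pair_graph_diamond near_diamond])
      (auto simp: diamond_def)
  moreover have "(0, 1) \<in> parcs diamond" by (simp add: diamond_def)
  ultimately show "\<exists>(G :: nat pair_pre_digraph) e.
            pair_graph G \<and> connected G \<and> diameter G = 2 \<and> e \<in> parcs G \<and>
              int (gp (delete_edge G e)) = int (gp G) - 1"
    using pair_graph_diamond gp_diamond gp_diamond_delete
    by (intro exI[of _ diamond] exI[of _ "(0, 1)"]) simp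
next
  have "diameter path3 = 2"
    by (rule pair_graph.diameter_eq_2I[OF pair_graph_path3 near_path3, of 0 2])
      (auto simp: path3_def)
  moreover have "connected path3"
    by (rule pair_graph.connectedI_near[OF pair_graph_path3 near_path3])
      (auto simp: path3_def)
  moreover have "(0, 1) \<in> parcs path3" by (simp add: path3_def)
  ultimately show "\<exists>(G :: nat pair_pre_digraph) e.
            pair_graph G \<and> connected G \<and> diameter G = 2 \<and> e \<in> parcs G \<and>
              int (gp (delete_edge G e)) = int (gp G) + 1"
    using pair_graph_path3 gp_path3 gp_path3_delete
    by (intro exI[of _ path3] exI[of _ "(0, 1)"]) simp
qed

end
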